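(* Let $n\ge 1$ and suppose that $\mathcal{D}=\{(A_i^{(1)},A_i^{(2)},A_i^{(3)})\}_{1\le i\le m}$ is a Bollobás system of $3$-partitions of $[n]$. Let $S=\bigcup_{i=1}^m\bigcup_{r=1}^3 A_i^{(r)}$ and $s=|S|$. Then $$\sum_{i=1}^{m}\binom{|A_i^{(1)}|+|A_i^{(2)}|+|A_i^{(3)}|}{|A_i^{(1)}|,|A_i^{(2)}|,|A_i^{(3)}|}^{-1}\le \left\lfloor\frac{s}{2}\right\rfloor+1.$$ Moreover, the upper bound is tight: for every positive integer $s$ there exists a Bollobás system of $3$-partitions of $[s]$ whose sets have union $[s]$ and for which equality holds.
   Context: For a positive integer $n$, $[n]=\{1,\dots,n\}$. A $3$-partition of $[n]$ is a triple $(A^{(1)},A^{(2)},A^{(3)})$ of (possibly empty) pairwise disjoint subsets of $[n]$; their union need not be all of $[n]$. A family $\{(A_i^{(1)},A_i^{(2)},A_i^{(3)})\}_{1\le i\le m}$ of $3$-partitions of $[n]$ is a Bollobás system if for any $1\le i,j\le m$ with $i\ne j$ there exist $1\le p<q\le 3$ such that $A_i^{(p)}\cap A_j^{(q)}\neq\emptyset$. For non-negative integers $a_1,a_2,a_3$ with $a_1+a_2+a_3\le N$, $\binom{N}{a_1,a_2,a_3}=\frac{N!}{a_1!a_2!a_3!(N-a_1-a_2-a_3)!}$. *)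

theory Defs
  imports Complex_Main "HOL-Library.Disjoint_Sets"
begin

text \<open>A triple \<open>(A\<^sup>1, A\<^sup>2, A\<^sup>3)\<close> is represented by a function \<open>A\<close> of the position, of which only
  the values \<open>A 1\<close>, \<open>A 2\<close>, \<open>A 3\<close> matter. The parts may be empty and need not cover \<open>{1..n}\<close>.\<close>

definition three_partition :: "nat \<Rightarrow> (nat \<Rightarrow> nat set) \<Rightarrow> bool" where
  "three_partition n A \<longleftrightarrow>
     (\<forall>r\<in>{1..3}. A r \<subseteq> {1..n}) \<and> disjoint_family_on A {1..3}"

text \<open>A family of \<open>m\<close> triples is indexed by \<open>{1..m}\<close>. The intersection condition is required for
  every ordered pair of distinct indices, that is, for both \<open>(i, j)\<close> and \<open>(j, i)\<close>.\<close>

definition bollobas_system :: "nat \<Rightarrow> nat \<Rightarrow> (nat \<Rightarrow> nat \<Rightarrow> nat set) \<Rightarrow> bool" where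
  "bollobas_system n m A \<longleftrightarrow>
     (\<forall>i\<in>{1..m}. three_partition n (A i)) \<and>
     (\<forall>i\<in>{1..m}. \<forall>j\<in>{1..m}. i \<noteq> j \<longrightarrow>
        (\<exists>p q. 1 \<le> p \<and> p < q \<and> q \<le> 3 \<and> A i p \<inter> A j q \<noteq> {}))"

definition system_union :: "nat \<Rightarrow> (nat \<Rightarrow> nat \<Rightarrow> nat set) \<Rightarrow> nat set" where
  "system_union m A = (\<Union>i\<in>{1..m}. \<Union>r\<in>{1..3}. A i r)"

text \<open>Natural subtraction truncates, so this is the multinomial coefficient only for
  \<open>a\<^sub>1 + a\<^sub>2 + a\<^sub>3 \<le> N\<close>.\<close>

definition multinomial3 :: "nat \<Rightarrow> nat \<Rightarrow> nat \<Rightarrow> nat \<Rightarrow> real" where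
  "multinomial3 N a\<^sub>1 a\<^sub>2 a\<^sub>3 =
     fact N / (fact a\<^sub>1 * fact a\<^sub>2 * fact a\<^sub>3 * fact (N - a\<^sub>1 - a\<^sub>2 - a\<^sub>3))"

definition bollobas_sum :: "nat \<Rightarrow> (nat \<Rightarrow> nat \<Rightarrow> nat set) \<Rightarrow> real" where
  "bollobas_sum m A =
     (\<Sum>i=1..m. inverse (multinomial3 (card (A i 1) + card (A i 2) + card (A i 3))
                             (card (A i 1)) (card (A i 2)) (card (A i 3))))"

end

theory Submission
  imports Defs "HOL-Combinatorics.Multiset_Permutations"
begin

text \<open>
  The proof is a double count of pairs \<open>(xs, i)\<close>, where \<open>xs\<close> is a permutation of the ground set
  \<open>S\<close> along which all of \<open>A\<^sub>i\<^sup>1\<close> comes before all of \<open>A\<^sub>i\<^sup>2\<close> and \<open>A\<^sub>i\<^sup>3\<close>, and all of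
  \<open>A\<^sub>i\<^sup>2\<close> before all of \<open>A\<^sub>i\<^sup>3\<close>. Call such a triple compatible with \<open>xs\<close>. A random
  permutation puts a given triple in order with probability exactly the inverse multinomial
  coefficient (\<open>card_compatible_permutations\<close>), so the sum in question is the average, over all
  permutations, of the number of compatible triples.

  This number never exceeds \<open>\<lfloor>s/2\<rfloor> + 1\<close>. Along \<open>xs\<close> a compatible triple is cut by two thresholds
  \<open>c \<le> d\<close> in \<open>{0..s}\<close>: part 1 lies at positions \<open>\<le> c\<close>, part 2 in \<open>(c, d]\<close> and part 3 beyond \<open>d\<close>.
  An element in an earlier part of \<open>i\<close> than of \<open>j\<close> forces \<open>c\<^sub>j < c\<^sub>i\<close> or \<open>d\<^sub>j < d\<^sub>i\<close>. As this
  holds for both orders of \<open>i\<close> and \<open>j\<close>, the threshold intervals are strictly nested, and their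
  lengths \<open>d - c \<in> {0..s}\<close> differ by at least 2 (\<open>card_compatible_triples_le\<close>).

  For tightness every permutation has to attain the bound. Take as triples the colour classes of
  all \<open>f : {1..s} \<rightarrow> {1, 2, 3}\<close> with average colour 2. Two different functions of equal sum
  cannot be comparable pointwise, which is the intersection condition. Along any permutation, for
  each \<open>k \<le> s/2\<close>, colouring the first \<open>k\<close> elements 1, the last \<open>k\<close> elements 3 and the rest 2 gives
  a compatible member of the family.
\<close>

section \<open>Permutations that list the parts of a family in order\<close>

definition compatible :: "'r::linorder set \<Rightarrow> ('r \<Rightarrow> 'a set) \<Rightarrow> 'a list \<Rightarrow> bool" where
  "compatible R A = sorted_wrt (\<lambda>x y. \<forall>p\<in>R. \<forall>q\<in>R. x \<in> A p \<longrightarrow> y \<in> A q \<longrightarrow> p \<le> q)"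

text \<open>The inverse of the multinomial coefficient with lower indices \<open>card (A r)\<close>.\<close>

definition compatible_fraction :: "'r set \<Rightarrow> ('r \<Rightarrow> 'a set) \<Rightarrow> real" where
  "compatible_fraction R A = (\<Prod>r\<in>R. fact (card (A r))) / fact (\<Sum>r\<in>R. card (A r))"

lemma compatible_Cons:
  "compatible R A (x # xs) \<longleftrightarrow>
     (\<forall>y\<in>set xs. \<forall>p\<in>R. \<forall>q\<in>R. x \<in> A p \<longrightarrow> y \<in> A q \<longrightarrow> p \<le> q) \<and> compatible R A xs"
  by (simp add: compatible_def)

lemma compatible_remove:
  assumes "x \<notin> set xs"
  shows "compatible R (\<lambda>r. A r - {x}) xs \<longleftrightarrow> compatible R A xs"
  unfolding compatible_def using assms
  by (intro iffI; elim sorted_wrt_mono_rel[rotated]) fastforce+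

text \<open>A compatible permutation is a first element that may precede everything else, followed by a
  compatible permutation of the remaining elements. The first element is deleted from the parts as
  well, so that they remain subsets of the ground set in an induction.\<close>

lemma card_compatible_Cons:
  assumes "finite S" "S \<noteq> {}"
  shows "card {xs \<in> permutations_of_set S. compatible R A xs} =
         (\<Sum>x\<in>S. if \<forall>y\<in>S - {x}. \<forall>p\<in>R. \<forall>q\<in>R. x \<in> A p \<longrightarrow> y \<in> A q \<longrightarrow> p \<le> q
                 then card {xs \<in> permutations_of_set (S - {x}). compatible R (\<lambda>r. A r - {x}) xs}
                 else 0)"
    (is "_ = (\<Sum>x\<in>S. if ?first x then card (?tails x) else 0)")
proof -
  define H where "H = {x \<in> S. ?first x}"
  define T where "T = (\<lambda>x. ?tails x)"
  have H: "H \<subseteq> S" by (auto simp: H_def)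
  have "{xs \<in> permutations_of_set S. compatible R A xs} = (\<Union>x\<in>H. (#) x ` T x)"
  proof (rule set_eqI)
    fix ys
    have "ys \<in> permutations_of_set S \<longleftrightarrow>
        (\<exists>x\<in>S. \<exists>xs\<in>permutations_of_set (S - {x}). ys = x # xs)"
      using permutations_of_set_nonempty[OF assms(2)] by auto
    moreover have "compatible R A (x # xs) \<longleftrightarrow> ?first x \<and> compatible R (\<lambda>r. A r - {x}) xs"
      if "xs \<in> permutations_of_set (S - {x})" for x xs
    proof -
      have "set xs = S - {x}" using that by (simp add: permutations_of_set_def)
      then show ?thesis using compatible_remove[of x xs R A] unfolding compatible_Cons by simp
    qed
    ultimately show "ys \<in> {xs \<in> permutations_of_set S. compatible R A xs} \<longleftrightarrow>
        ys \<in> (\<Union>x\<in>H. (#) x ` T x)"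
      unfolding H_def T_def by blast
  qed
  moreover have "finite H" "finite (T x)" for x
    using H assms(1) by (auto simp: T_def intro: finite_subset)
  ultimately have "card {xs \<in> permutations_of_set S. compatible R A xs} =
      (\<Sum>x\<in>H. card ((#) x ` T x))"
    by (simp only:) (intro card_UN_disjoint, auto)
  also have "\<dots> = (\<Sum>x\<in>H. card (T x))"
    by (simp add: card_image)
  also have "\<dots> = (\<Sum>x\<in>S. if ?first x then card (T x) else 0)"
    unfolding H_def by (rule sum.inter_filter[OF assms(1)])
  finally show ?thesis unfolding T_def .
qed

text \<open>Only the part \<open>A r\<close> shrinks, so the numerator loses the factor \<open>card (A r)\<close>, and the
  denominator loses the factor \<open>\<Sum>q\<in>R. card (A q)\<close>. The identity is multiplied out to avoid
  division.\<close>

lemma compatible_fraction_remove: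
  assumes "finite R" "disjoint_family_on A R" "r \<in> R" "x \<in> A r" "\<And>q. q \<in> R \<Longrightarrow> finite (A q)"
  shows "compatible_fraction R (\<lambda>q. A q - {x}) * card (A r) =
         compatible_fraction R A * (\<Sum>q\<in>R. card (A q))"
proof -
  have other: "A q - {x} = A q" if "q \<in> R - {r}" for q
    using assms(2-4) that by (auto simp: disjoint_family_on_def)
  define T where "T = (\<Sum>q\<in>R - {r}. card (A q))"
  define P :: real where "P = (\<Prod>q\<in>R - {r}. fact (card (A q)))"
  obtain a where a: "card (A r) = Suc a" "card (A r - {x}) = a"
    using assms(3-5) by (metis card_Suc_Diff1)
  have "(\<Sum>q\<in>R. card (A q)) = Suc (a + T)" "(\<Sum>q\<in>R. card (A q - {x})) = a + T"
    using assms(1,3) a other by (simp_all add: sum.remove[of R r] T_def)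
  moreover have "(\<Prod>q\<in>R. fact (card (A q)) :: real) = fact (Suc a) * P"
      "(\<Prod>q\<in>R. fact (card (A q - {x})) :: real) = fact a * P"
    using assms(1,3) a other by (simp_all add: prod.remove[of R r] P_def)
  ultimately show ?thesis
    unfolding compatible_fraction_def a by (simp del: of_nat_Suc add: fact_Suc)
qed

text \<open>Induction on the ground set, according to the first element of the permutation. Let \<open>b\<close> be
  the total size of the parts, \<open>r\<close> the least index of a nonempty part and \<open>w\<close> the claimed
  fraction. Starting with one of the \<open>card S - b\<close> elements outside all parts changes nothing and
  contributes \<open>(card S - 1)! * w\<close>. Starting with one of the elements of \<open>A r\<close> contributes
  \<open>(card S - 1)! * w * b / card (A r)\<close>. All other elements have to wait for \<open>A r\<close>. The
  contributions add up to \<open>(card S - 1)! * w * (card S - b + b)\<close>.\<close>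

lemma card_compatible_permutations:
  assumes "finite S" "finite R" "disjoint_family_on A R" "\<And>r. r \<in> R \<Longrightarrow> A r \<subseteq> S"
  shows "real (card {xs \<in> permutations_of_set S. compatible R A xs}) =
         fact (card S) * compatible_fraction R A"
  using assms(1,3,4)
proof (induction S arbitrary: A rule: finite_psubset_induct)
  case (psubset S)
  have fin: "finite (A r)" if "r \<in> R" for r
    using psubset.prems(2)[OF that] \<open>finite S\<close> by (rule finite_subset)
  show ?case
  proof (cases "\<forall>r\<in>R. A r = {}")
    case True
    then have "compatible R A xs" for xs
      unfolding compatible_def by (induction xs) auto
    then show ?thesis
      using True psubset.hyps by (simp add: compatible_fraction_def)
  next
    case False
    define r where "r = Min {q \<in> R. A q \<noteq> {}}"
    have "r \<in> {q \<in> R. A q \<noteq> {}}"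
      unfolding r_def using False \<open>finite R\<close> by (intro Min_in) auto
    then have r: "r \<in> R" "A r \<noteq> {}" by auto
    have r_least: "r \<le> q" if "q \<in> R" "y \<in> A q" for q y
      unfolding r_def using that \<open>finite R\<close> by (intro Min_le) auto
    define B where "B = (\<Union>q\<in>R. A q)"
    have B: "B \<subseteq> S" "A r \<subseteq> B" "finite B"
      using psubset.prems(2) r psubset.hyps unfolding B_def by (blast intro: finite_subset)+
    have card_B: "card B = (\<Sum>q\<in>R. card (A q))"
      unfolding B_def using fin \<open>finite R\<close> psubset.prems(1)
      by (intro card_UN_disjoint) (auto simp: disjoint_family_on_def)
    have only: "q = q'" if "q \<in> R" "q' \<in> R" "x \<in> A q" "x \<in> A q'" for x q q'
      using psubset.prems(1) that by (auto simp: disjoint_family_on_def)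
    define w where "w = compatible_fraction R A"
    define g where "g x = (if \<forall>y\<in>S - {x}. \<forall>p\<in>R. \<forall>q\<in>R. x \<in> A p \<longrightarrow> y \<in> A q \<longrightarrow> p \<le> q
       then card {xs \<in> permutations_of_set (S - {x}). compatible R (\<lambda>r. A r - {x}) xs} else 0)" for x
    have IH: "real (card {xs \<in> permutations_of_set (S - {x}). compatible R (\<lambda>r. A r - {x}) xs}) =
        fact (card S - 1) * compatible_fraction R (\<lambda>r. A r - {x})" if "x \<in> S" for x
      using that psubset.prems psubset.hyps
      by (subst psubset.IH) (auto simp: disjoint_family_on_def)
    have g_outside: "real (g x) = fact (card S - 1) * w" if "x \<in> S - B" for x
    proof -
      have "compatible_fraction R (\<lambda>r. A r - {x}) = w"
        unfolding w_def compatible_fraction_def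
        using that by (auto simp: B_def intro!: arg_cong2[where f = "(/)"] prod.cong sum.cong
              arg_cong[where f = fact])
      moreover have "\<forall>q\<in>R. x \<notin> A q" using that by (auto simp: B_def)
      ultimately show ?thesis using IH[of x] that by (simp add: g_def)
    qed
    have g_first: "real (g x) = fact (card S - 1) * w * card B / card (A r)" if "x \<in> A r" for x
    proof -
      have "\<forall>y\<in>S - {x}. \<forall>p\<in>R. \<forall>q\<in>R. x \<in> A p \<longrightarrow> y \<in> A q \<longrightarrow> p \<le> q"
        using r_least only r(1) that by blast
      then have "real (g x) = fact (card S - 1) * compatible_fraction R (\<lambda>r. A r - {x})"
        using IH[of x] that B by (auto simp: g_def)
      moreover have "compatible_fraction R (\<lambda>q. A q - {x}) * card (A r) = w * card B"
        unfolding w_def card_B using \<open>finite R\<close> psubset.prems(1) r(1) that fin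
        by (intro compatible_fraction_remove) auto
      moreover have "card (A r) \<noteq> 0" using r fin by simp
      ultimately show ?thesis by (simp add: field_simps)
    qed
    have g_later: "g x = 0" if x: "x \<in> B - A r" for x
    proof -
      obtain q where "q \<in> R" "x \<in> A q" using x by (auto simp: B_def)
      moreover obtain y where "y \<in> A r" using r(2) by blast
      moreover from calculation have "y \<in> S - {x}" "\<not> q \<le> r"
        using that B r_least[of q x] by (auto simp: order.antisym)
      ultimately show ?thesis unfolding g_def using r(1) by auto
    qed
    have ne: "S \<noteq> {}" "card S \<noteq> 0" using r B psubset.hyps by auto
    have "real (card {xs \<in> permutations_of_set S. compatible R A xs}) = (\<Sum>x\<in>S. real (g x))"
      by (simp add: card_compatible_Cons[OF psubset.hyps ne(1)] g_def)
    also have "\<dots> = (\<Sum>x\<in>S - B. real (g x)) + (\<Sum>x\<in>B. real (g x))"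
      using B psubset.hyps by (simp add: sum.subset_diff)
    also have "(\<Sum>x\<in>B. real (g x)) = (\<Sum>x\<in>A r. real (g x))"
      using B g_later by (intro sum.mono_neutral_right) auto
    also have "(\<Sum>x\<in>A r. real (g x)) = fact (card S - 1) * w * card B"
      using r fin by (simp add: g_first)
    also have "(\<Sum>x\<in>S - B. real (g x)) = (real (card S) - card B) * (fact (card S - 1) * w)"
      using B psubset.hyps by (simp add: g_outside card_Diff_subset card_mono of_nat_diff)
    also have "\<dots> + fact (card S - 1) * w * card B = fact (card S) * w"
      using ne by (simp add: fact_reduce[of "card S"] algebra_simps)
    finally show ?thesis by (simp add: w_def)
  qed
qed

text \<open>The double count, which yields both the upper bound and the value for the extremal
  system.\<close>

lemma sum_compatible_fraction:
  assumes "finite S" "finite R" "finite I"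
    and "\<And>i. i \<in> I \<Longrightarrow> disjoint_family_on (A i) R"
    and "\<And>i r. i \<in> I \<Longrightarrow> r \<in> R \<Longrightarrow> A i r \<subseteq> S"
  shows "fact (card S) * (\<Sum>i\<in>I. compatible_fraction R (A i)) =
         (\<Sum>xs\<in>permutations_of_set S. real (card {i \<in> I. compatible R (A i) xs}))"
proof -
  have "fact (card S) * (\<Sum>i\<in>I. compatible_fraction R (A i)) =
        (\<Sum>i\<in>I. real (card {xs \<in> permutations_of_set S. compatible R (A i) xs}))"
    using assms by (simp add: sum_distrib_left card_compatible_permutations)
  also have "\<dots> = real (\<Sum>i\<in>I. card {xs \<in> permutations_of_set S. compatible R (A i) xs})"
    by simp
  also have "(\<Sum>i\<in>I. card {xs \<in> permutations_of_set S. compatible R (A i) xs}) =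
      (\<Sum>xs\<in>permutations_of_set S. card {i \<in> I. compatible R (A i) xs})"
    using assms(3) by (intro sum_multicount_gen) auto
  finally show ?thesis by simp
qed

section \<open>At most \<open>s div 2 + 1\<close> triples are compatible with one permutation\<close>

text \<open>Used in both orders, the hypothesis makes the intervals from \<open>c i\<close> to \<open>d i\<close> strictly nested
  at both ends, so the lengths differ by at least 2 and their halves in \<open>{..s div 2}\<close> are
  distinct.\<close>

lemma card_antichain_below_diagonal:
  fixes c d :: "'i \<Rightarrow> nat"
  assumes "\<And>i. i \<in> I \<Longrightarrow> c i \<le> d i \<and> d i \<le> s"
    and anti: "\<And>i j. i \<in> I \<Longrightarrow> j \<in> I \<Longrightarrow> i \<noteq> j \<Longrightarrow> c j < c i \<or> d j < d i"
  shows "card I \<le> s div 2 + 1"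
proof -
  have "inj_on (\<lambda>i. (d i - c i) div 2) I"
  proof (rule inj_onI, rule ccontr)
    fix i j assume ij: "i \<in> I" "j \<in> I" "(d i - c i) div 2 = (d j - c j) div 2" "i \<noteq> j"
    have le: "c i \<le> d i" "c j \<le> d j" using assms(1) ij by auto
    have "c j < c i \<or> d j < d i" "c i < c j \<or> d i < d j" using anti ij by auto
    then consider "c j < c i" "d i < d j" | "c i < c j" "d j < d i" by linarith
    then have "d i - c i + 2 \<le> d j - c j \<or> d j - c j + 2 \<le> d i - c i"
      using le by cases linarith+
    then show False using ij(3) by linarith
  qed
  moreover have "(\<lambda>i. (d i - c i) div 2) ` I \<subseteq> {..s div 2}"
    using assms(1) by (auto intro!: div_le_mono intro: order_trans[OF diff_le_self])
  ultimately show ?thesis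
    using card_inj_on_le[of _ I "{..s div 2}"] by simp
qed

text \<open>The thresholds are the last position of part 1 and the last position of parts 1 and 2.
  Positions are counted from 1, so that 0 can serve as the threshold when those parts are
  empty.\<close>

lemma card_ordered_triples_le:
  fixes A :: "'i \<Rightarrow> nat \<Rightarrow> 'a set" and pos :: "'a \<Rightarrow> nat"
  assumes range: "\<And>i r x. i \<in> I \<Longrightarrow> r \<in> {1..3} \<Longrightarrow> x \<in> A i r \<Longrightarrow> 0 < pos x \<and> pos x \<le> s"
    and order: "\<And>i p q x y. i \<in> I \<Longrightarrow> 1 \<le> p \<Longrightarrow> p < q \<Longrightarrow> q \<le> 3 \<Longrightarrow>
                  x \<in> A i p \<Longrightarrow> y \<in> A i q \<Longrightarrow> pos x < pos y"
    and cross: "\<And>i j. i \<in> I \<Longrightarrow> j \<in> I \<Longrightarrow> i \<noteq> j \<Longrightarrow>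
                  \<exists>p q. 1 \<le> p \<and> p < q \<and> q \<le> 3 \<and> A i p \<inter> A j q \<noteq> {}"
  shows "card I \<le> s div 2 + 1"
proof -
  define c where "c i = Max (insert 0 (pos ` A i 1))" for i
  define d where "d i = Max (insert 0 (pos ` (A i 1 \<union> A i 2)))" for i
  have fin: "finite (insert 0 (pos ` A i 1))" "finite (insert 0 (pos ` (A i 1 \<union> A i 2)))"
    if "i \<in> I" for i
    using range[OF that, of 1] range[OF that, of 2]
    by (auto intro: finite_subset[of _ "{..s}"])
  show ?thesis
  proof (rule card_antichain_below_diagonal)
    fix i assume i: "i \<in> I"
    show "c i \<le> d i \<and> d i \<le> s"
      unfolding c_def d_def using fin[OF i] range[OF i, of 1] range[OF i, of 2]
      by (auto intro!: Max_mono)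
  next
    have le_c: "pos x \<le> c i" if "i \<in> I" "x \<in> A i 1" for i x
      unfolding c_def using that fin by (intro Max_ge) auto
    have le_d: "pos x \<le> d i" if "i \<in> I" "x \<in> A i 1 \<union> A i 2" for i x
      unfolding d_def using that fin by (intro Max_ge) auto
    have gt_c: "c i < pos x" if "i \<in> I" "q \<in> {2, 3}" "x \<in> A i q" for i q x
      unfolding c_def using that fin order[of i 1 q _ x] range[of i q x] by auto
    have gt_d: "d i < pos x" if "i \<in> I" "x \<in> A i 3" for i x
      unfolding d_def using that fin order[of i 1 3 _ x] order[of i 2 3 _ x] range[of i 3 x] by auto
    fix i j assume ij: "i \<in> I" "j \<in> I" "i \<noteq> j"
    then obtain p q x where pq: "1 \<le> p" "p < q" "q \<le> 3" and x: "x \<in> A i p" "x \<in> A j q"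
      using cross[of i j] by auto
    consider "p = 1" "q \<in> {2, 3}" | "p = 2" "q = 3"
      using pq by fastforce
    then show "c j < c i \<or> d j < d i"
    proof cases
      case 1
      then show ?thesis using le_c[of i x] gt_c[of j q x] x ij by auto
    next
      case 2
      then show ?thesis using le_d[of i x] gt_d[of j x] x ij by auto
    qed
  qed
qed

text \<open>A position function turns \<open>compatible\<close>, which quantifies over list indices, into an
  order condition on elements.\<close>

lemma distinct_list_positions:
  assumes "distinct xs"
  obtains pos :: "'a \<Rightarrow> nat" where "bij_betw pos (set xs) {..<length xs}"
    and "\<forall>j<length xs. pos (xs ! j) = j" and "\<forall>x\<in>set xs. xs ! pos x = x"
proof -
  have bij: "bij_betw ((!) xs) {..<length xs} (set xs)"
    using assms by (simp add: bij_betw_nth)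
  let ?pos = "the_inv_into {..<length xs} ((!) xs)"
  show thesis
  proof
    show "bij_betw ?pos (set xs) {..<length xs}" by (rule bij_betw_the_inv_into[OF bij])
    show "\<forall>j<length xs. ?pos (xs ! j) = j"
      using bij by (simp add: the_inv_into_f_f bij_betw_def)
    show "\<forall>x\<in>set xs. xs ! ?pos x = x"
      using bij by (auto intro: f_the_inv_into_f_bij_betw)
  qed
qed

lemma compatible_iff_positions:
  assumes "\<And>x. x \<in> set xs \<Longrightarrow> pos x < length xs \<and> xs ! pos x = x"
    and "\<And>j. j < length xs \<Longrightarrow> pos (xs ! j) = j"
  shows "compatible R A xs \<longleftrightarrow> (\<forall>x\<in>set xs. \<forall>y\<in>set xs. pos x < pos y \<longrightarrow>
           (\<forall>p\<in>R. \<forall>q\<in>R. x \<in> A p \<longrightarrow> y \<in> A q \<longrightarrow> p \<le> q))"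
  unfolding compatible_def sorted_wrt_iff_nth_less
proof (intro iffI ballI allI impI, goal_cases)
  case (1 x y p q)
  have "x = xs ! pos x" "y = xs ! pos y" "pos y < length xs"
    using assms(1)[OF 1(2)] assms(1)[OF 1(3)] by auto
  then show ?case using 1(1)[rule_format, of "pos x" "pos y" p q] 1(4-) by simp
next
  case (2 i j p q)
  have "pos (xs ! i) = i" "pos (xs ! j) = j" "xs ! i \<in> set xs" "xs ! j \<in> set xs"
    using assms(2)[of i] assms(2)[of j] 2(2,3) by auto
  then show ?case using 2(1)[rule_format, of "xs ! i" "xs ! j" p q] 2(2-) by simp
qed

text \<open>Compatibility only says \<open>p \<le> q\<close> for elements in the order of the list. Disjointness of the
  parts turns this into the strict order of positions that the thresholds need.\<close>

lemma card_compatible_triples_le: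
  assumes "\<And>i. i \<in> I \<Longrightarrow> disjoint_family_on (A i) {1..3}"
    and sub: "\<And>i r. i \<in> I \<Longrightarrow> r \<in> {1..3} \<Longrightarrow> A i r \<subseteq> S"
    and cross: "\<And>i j. i \<in> I \<Longrightarrow> j \<in> I \<Longrightarrow> i \<noteq> j \<Longrightarrow>
                  \<exists>p q. 1 \<le> p \<and> p < q \<and> q \<le> 3 \<and> A i p \<inter> A j q \<noteq> {}"
    and xs: "xs \<in> permutations_of_set S"
  shows "card {i \<in> I. compatible {1..3::nat} (A i) xs} \<le> card S div 2 + 1"
proof -
  have set_xs: "set xs = S" "distinct xs" "length xs = card S"
    using xs by (auto simp: permutations_of_set_def distinct_card)
  obtain pos where pos: "bij_betw pos (set xs) {..<length xs}"
      "\<forall>j<length xs. pos (xs ! j) = j" "\<forall>x\<in>set xs. xs ! pos x = x"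
    using distinct_list_positions[OF set_xs(2)] .
  have lt: "pos x < length xs" if "x \<in> set xs" for x
    using pos(1) that by (auto simp: bij_betw_def)
  have resp: "compatible {1..3::nat} (A i) xs \<longleftrightarrow> (\<forall>x\<in>set xs. \<forall>y\<in>set xs. pos x < pos y \<longrightarrow>
           (\<forall>p\<in>{1..3}. \<forall>q\<in>{1..3}. x \<in> A i p \<longrightarrow> y \<in> A i q \<longrightarrow> p \<le> q))" for i
    using lt pos by (intro compatible_iff_positions) auto
  show ?thesis
  proof (rule card_ordered_triples_le[where A = A and pos = "\<lambda>x. Suc (pos x)"])
    fix i r x assume "i \<in> {i \<in> I. compatible {1..3} (A i) xs}" "r \<in> {1..3}" "x \<in> A i r"
    then show "0 < Suc (pos x) \<and> Suc (pos x) \<le> card S"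
      using sub[of i r] lt[of x] set_xs by auto
  next
    fix i p q x y
    assume i: "i \<in> {i \<in> I. compatible {1..3} (A i) xs}" and pq: "1 \<le> p" "p < q" "q \<le> (3::nat)"
      and xy: "x \<in> A i p" "y \<in> A i q"
    have S: "x \<in> set xs" "y \<in> set xs" using i pq xy sub[of i p] sub[of i q] set_xs by auto
    have "\<not> pos y < pos x"
    proof
      assume "pos y < pos x"
      have "compatible {1..3} (A i) xs" using i by simp
      from this[unfolded resp, rule_format, OF S(2,1) \<open>pos y < pos x\<close>, of q p]
      have "q \<le> p" using pq xy by simp
      then show False using pq by simp
    qed
    moreover have "A i p \<inter> A i q = {}"
      using i pq assms(1)[of i] by (intro disjoint_family_onD) auto
    then have "x \<noteq> y" using xy by blast
    then have "pos x \<noteq> pos y" using S pos(3) by metis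
    ultimately show "Suc (pos x) < Suc (pos y)" by simp
  next
    fix i j assume "i \<in> {i \<in> I. compatible {1..3} (A i) xs}" "j \<in> {i \<in> I. compatible {1..3} (A i) xs}"
      "i \<noteq> j"
    then show "\<exists>p q. 1 \<le> p \<and> p < q \<and> q \<le> 3 \<and> A i p \<inter> A j q \<noteq> {}"
      using cross by simp
  qed
qed

section \<open>The upper bound\<close>

lemma bollobas_sum_eq: "bollobas_sum m A = (\<Sum>i=1..m. compatible_fraction {1..3} (A i))"
proof -
  have "{1..3} = {1, 2, 3::nat}" by auto
  then show ?thesis
    by (simp add: bollobas_sum_def compatible_fraction_def multinomial3_def add.assoc mult.assoc)
qed

lemma floor_half_nat: "real_of_int (\<lfloor>real k / 2\<rfloor> + 1) = real (k div 2 + 1)"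
  by (simp add: floor_divide_of_nat_eq[of k 2, simplified])

lemma bollobas_sum_le:
  assumes "bollobas_system n m A"
  shows "bollobas_sum m A \<le> real (card (system_union m A) div 2 + 1)"
proof -
  define S where "S = system_union m A"
  have S: "A i r \<subseteq> S" if "i \<in> {1..m}" "r \<in> {1..3}" for i r
    using that unfolding S_def system_union_def by blast
  have "S \<subseteq> {1..n}"
    using assms unfolding S_def system_union_def bollobas_system_def three_partition_def by blast
  then have "finite S" by (rule finite_subset) simp
  have disj: "disjoint_family_on (A i) {1..3}" if "i \<in> {1..m}" for i
    using assms that by (auto simp: bollobas_system_def three_partition_def)
  have cross: "\<exists>p q. 1 \<le> p \<and> p < q \<and> q \<le> 3 \<and> A i p \<inter> A j q \<noteq> {}"
    if "i \<in> {1..m}" "j \<in> {1..m}" "i \<noteq> j" for i j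
    using assms that unfolding bollobas_system_def by blast
  have "fact (card S) * bollobas_sum m A =
      (\<Sum>xs\<in>permutations_of_set S. real (card {i \<in> {1..m}. compatible {1..3} (A i) xs}))"
    unfolding bollobas_sum_eq using \<open>finite S\<close> disj S by (intro sum_compatible_fraction) auto
  also have "\<dots> \<le> (\<Sum>xs\<in>permutations_of_set S. real (card S div 2 + 1))"
    by (intro sum_mono of_nat_mono card_compatible_triples_le disj S cross)
  also have "\<dots> = fact (card S) * real (card S div 2 + 1)"
    using \<open>finite S\<close> by simp
  finally show ?thesis unfolding S_def by simp
qed

section \<open>A system attaining the bound\<close>

text \<open>The functions are extensional, so that different members differ at some element of
  \<open>{1..s}\<close> and the set is finite.\<close>

definition balanced_colourings :: "nat \<Rightarrow> (nat \<Rightarrow> nat) set" where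
  "balanced_colourings s = {f \<in> {1..s} \<rightarrow>\<^sub>E {1..3}. sum f {1..s} = 2 * s}"

definition colour_class :: "nat \<Rightarrow> (nat \<Rightarrow> nat) \<Rightarrow> nat \<Rightarrow> nat set" where
  "colour_class s f r = {x \<in> {1..s}. f x = r}"

lemma finite_balanced_colourings: "finite (balanced_colourings s)"
  unfolding balanced_colourings_def by (simp add: finite_PiE)

text \<open>If no element had a smaller colour under \<open>f\<close> than under \<open>g\<close>, then \<open>g \<le> f\<close> pointwise, and
  equality of the sums would force \<open>f = g\<close>.\<close>

lemma balanced_colourings_cross:
  assumes "f \<in> balanced_colourings s" "g \<in> balanced_colourings s" "f \<noteq> g"
  shows "\<exists>p q. 1 \<le> p \<and> p < q \<and> q \<le> 3 \<and> colour_class s f p \<inter> colour_class s g q \<noteq> {}"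
proof -
  have f: "f \<in> {1..s} \<rightarrow>\<^sub>E {1..3}" "sum f {1..s} = 2 * s"
    and g: "g \<in> {1..s} \<rightarrow>\<^sub>E {1..3}" "sum g {1..s} = 2 * s"
    using assms by (auto simp: balanced_colourings_def)
  have "\<exists>x\<in>{1..s}. f x < g x"
  proof (rule ccontr)
    assume *: "\<not> ?thesis"
    have le: "g x \<le> f x" if "x \<in> {1..s}" for x
      using * that by (meson not_less)
    have "g x = f x" if "x \<in> {1..s}" for x
      using f(2) g(2) le that by (intro sum_mono_inv[of g "{1..s}" f]) simp_all
    then show False using \<open>f \<noteq> g\<close> PiE_ext[OF f(1) g(1)] by metis
  qed
  then obtain x where x: "x \<in> {1..s}" "f x < g x" by blast
  then have "1 \<le> f x" "g x \<le> 3" using f(1) g(1) by (auto simp: PiE_iff)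
  moreover have "x \<in> colour_class s f (f x) \<inter> colour_class s g (g x)"
    using x by (simp add: colour_class_def)
  ultimately show ?thesis using x(2) by blast
qed

lemma disjoint_colour_class: "disjoint_family_on (colour_class s f) R"
  by (auto simp: disjoint_family_on_def colour_class_def)

text \<open>The colour of list position \<open>j < s\<close>: \<open>k\<close> ones, then twos, then \<open>k\<close> threes.\<close>

definition step_colour :: "nat \<Rightarrow> nat \<Rightarrow> nat \<Rightarrow> nat" where
  "step_colour s k j = (if j < k then 1 else if j < s - k then 2 else 3)"

text \<open>Reversing the positions exchanges the colours 1 and 3, so opposite positions have colours
  adding up to 4.\<close>

lemma sum_step_colour:
  assumes "k \<le> s div 2"
  shows "(\<Sum>j<s. step_colour s k j) = 2 * s"
proof -
  have "2 * (\<Sum>j<s. step_colour s k j) =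
        (\<Sum>j<s. step_colour s k j) + (\<Sum>j<s. step_colour s k (s - Suc j))"
    by (simp add: sum.nat_diff_reindex)
  also have "\<dots> = (\<Sum>j<s. step_colour s k j + step_colour s k (s - Suc j))"
    by (simp add: sum.distrib)
  also have "\<dots> = (\<Sum>j<s. 4)"
    using assms by (intro sum.cong) (auto simp: step_colour_def)
  finally show ?thesis by simp
qed

text \<open>Placing the step colourings for \<open>k = 0, \<dots>, s div 2\<close> along \<open>xs\<close> gives that many compatible
  members of the family. For \<open>k < l\<close> they differ at position \<open>k\<close>, where only
  the one for \<open>l\<close> has colour 1.\<close>

lemma card_compatible_colourings_ge:
  assumes xs: "xs \<in> permutations_of_set {1..s}"
  shows "s div 2 + 1 \<le>
         card {f \<in> balanced_colourings s. compatible {1..3} (colour_class s f) xs}"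
proof -
  have set_xs: "set xs = {1..s}" "distinct xs" "length xs = s"
    using xs by (auto simp: permutations_of_set_def dest: distinct_card)
  obtain pos where pos: "bij_betw pos (set xs) {..<length xs}"
      "\<forall>j<length xs. pos (xs ! j) = j" "\<forall>x\<in>set xs. xs ! pos x = x"
    using distinct_list_positions[OF set_xs(2)] .
  have lt: "pos x < length xs" if "x \<in> set xs" for x
    using pos(1) that by (auto simp: bij_betw_def)
  define F where "F k = restrict (\<lambda>x. step_colour s k (pos x)) {1..s}" for k
  have F_nth: "F k (xs ! j) = step_colour s k j" if "j < s" for k j
    using that pos(2) set_xs nth_mem[of j xs] by (simp add: F_def)
  have "F ` {..s div 2} \<subseteq> {f \<in> balanced_colourings s. compatible {1..3} (colour_class s f) xs}"
  proof (rule image_subsetI)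
    fix k assume "k \<in> {..s div 2}"
    then have k: "k \<le> s div 2" by simp
    have "sum (F k) {1..s} = (\<Sum>x\<in>{1..s}. step_colour s k (pos x))"
      by (simp add: F_def)
    also have "\<dots> = (\<Sum>j<s. step_colour s k j)"
      using pos(1) set_xs by (intro sum.reindex_bij_betw) simp
    finally have "F k \<in> balanced_colourings s"
      using sum_step_colour[OF k] by (auto simp: balanced_colourings_def F_def step_colour_def)
    moreover have "compatible {1..3} (colour_class s (F k)) xs"
      unfolding compatible_def sorted_wrt_iff_nth_less
      using F_nth set_xs(3) by (auto simp: colour_class_def step_colour_def)
    ultimately show "F k \<in> {f \<in> balanced_colourings s. compatible {1..3} (colour_class s f) xs}"
      by simp
  qed
  moreover have "inj_on F {..s div 2}"
  proof (rule linorder_inj_onI)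
    fix k l assume kl: "k < l" "k \<in> {..s div 2}" "l \<in> {..s div 2}"
    then have "step_colour s k k \<noteq> step_colour s l k" "k < s"
      by (auto simp: step_colour_def)
    then show "F k \<noteq> F l" using F_nth by metis
  qed (rule nat_le_linear)
  ultimately have "card {..s div 2} \<le>
      card {f \<in> balanced_colourings s. compatible {1..3} (colour_class s f) xs}"
    using finite_balanced_colourings by (intro card_inj_on_le[of F]) auto
  then show ?thesis by simp
qed

text \<open>Each permutation contributes at least \<open>s div 2 + 1\<close> to the double count. Equality then
  follows from the upper bound for the same system, so the compatible colourings need not be
  counted exactly.\<close>

lemma ex_extremal_system:
  "\<exists>m A. bollobas_system s m A \<and> system_union m A = {1..s} \<and>
         bollobas_sum m A = real (s div 2 + 1)"
proof -
  let ?F = "balanced_colourings s"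
  obtain e where e: "bij_betw e {1..card ?F} ?F"
    using ex_bij_betw_nat_finite_1[OF finite_balanced_colourings] by blast
  define m where "m = card ?F"
  define A where "A i = colour_class s (e i)" for i
  have e_in: "e i \<in> ?F" if "i \<in> {1..m}" for i
    using e that by (auto simp: m_def bij_betw_def)
  have e_neq: "e i \<noteq> e j" if "i \<in> {1..m}" "j \<in> {1..m}" "i \<noteq> j" for i j
    using inj_onD[OF bij_betw_imp_inj_on[OF e], of i j] that by (auto simp: m_def)
  have sys: "bollobas_system s m A"
    unfolding bollobas_system_def
  proof (intro conjI ballI impI)
    show "three_partition s (A i)" for i
      using disjoint_colour_class by (auto simp: three_partition_def A_def colour_class_def)
    fix i j assume "i \<in> {1..m}" "j \<in> {1..m}" "i \<noteq> j"
    then show "\<exists>p q. 1 \<le> p \<and> p < q \<and> q \<le> 3 \<and> A i p \<inter> A j q \<noteq> {}"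
      unfolding A_def by (intro balanced_colourings_cross e_in e_neq)
  qed
  have "(\<lambda>x\<in>{1..s}. 2) \<in> ?F" by (auto simp: balanced_colourings_def)
  then have "m > 0" unfolding m_def using finite_balanced_colourings by (auto simp: card_gt_0_iff)
  then have "e 1 \<in> ?F" by (intro e_in) auto
  then have "x \<in> A 1 (e 1 x)" "e 1 x \<in> {1..3}" if "x \<in> {1..s}" for x
    using that by (auto simp: A_def colour_class_def balanced_colourings_def PiE_iff)
  then have "{1..s} \<subseteq> system_union m A"
    unfolding system_union_def using \<open>m > 0\<close> by (force intro!: UN_I[of 1])
  moreover have "system_union m A \<subseteq> {1..s}"
    by (auto simp: system_union_def A_def colour_class_def)
  ultimately have union: "system_union m A = {1..s}" by blast
  have "fact s * real (s div 2 + 1) = (\<Sum>xs\<in>permutations_of_set {1..s}. real (s div 2 + 1))"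
    by simp
  also have "\<dots> \<le> (\<Sum>xs\<in>permutations_of_set {1..s}.
                    real (card {f \<in> ?F. compatible {1..3} (colour_class s f) xs}))"
    by (intro sum_mono of_nat_mono card_compatible_colourings_ge)
  also have "\<dots> = fact (card {1..s}) * (\<Sum>f\<in>?F. compatible_fraction {1..3} (colour_class s f))"
    by (rule sum_compatible_fraction[symmetric])
       (auto simp: finite_balanced_colourings disjoint_colour_class, auto simp: colour_class_def)
  also have "(\<Sum>f\<in>?F. compatible_fraction {1..3} (colour_class s f)) = bollobas_sum m A"
    unfolding bollobas_sum_eq A_def m_def by (rule sum.reindex_bij_betw[OF e, symmetric])
  finally have "real (s div 2 + 1) \<le> bollobas_sum m A" by simp
  moreover have "bollobas_sum m A \<le> real (s div 2 + 1)"
    using bollobas_sum_le[OF sys] union by simp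
  ultimately show ?thesis using sys union by fastforce
qed

theorem theorem1p8:
  shows "(\<forall>(n::nat) (m::nat) (A :: nat \<Rightarrow> nat \<Rightarrow> nat set).
            n \<ge> 1 \<longrightarrow> bollobas_system n m A \<longrightarrow>
            bollobas_sum m A \<le> real_of_int (\<lfloor>real (card (system_union m A)) / 2\<rfloor> + 1)) \<and>
         (\<forall>s::nat. s \<ge> 1 \<longrightarrow>
            (\<exists>(m::nat) (A :: nat \<Rightarrow> nat \<Rightarrow> nat set).
               bollobas_system s m A \<and> system_union m A = {1..s} \<and>
               bollobas_sum m A = real_of_int (\<lfloor>real s / 2\<rfloor> + 1)))"
  unfolding floor_half_nat using bollobas_sum_le ex_extremal_system by blast

end
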